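(* Let $b,c\in\mathbb{O}$. The solutions $x\in\mathbb{O}$ of the left octonionic quadratic equation $x^2+bx+c=0$ are obtained by the following formulas, according to the following cases. Case 1. If $b,c\in\mathbb{R}$ and $b^2\ge 4c$, then $$x=\frac{-b\pm\sqrt{b^2-4c}}{2}.$$ Case 2. If $b,c\in\mathbb{R}$ and $b^2<4c$, then $$x=\tfrac12\left(-b+\alpha\, i+\beta\, j+\gamma\, k+\delta\, l+p\, il+q\, jl+r\, kl\right),$$ where $\alpha,\beta,\gamma,\delta,p,q,r\in\mathbb{R}$ and $\alpha^2+\beta^2+\gamma^2+\delta^2+p^2+q^2+r^2=4c-b^2$. Case 3. If $b\in\mathbb{R}$ and $c\notin\mathbb{R}$, then $$x=\frac{-b}{2}\pm\frac{\rho}{2}\mp\frac{c_1}{\rho}i\mp\frac{c_2}{\rho}j\mp\frac{c_3}{\rho}k\mp\frac{c_4}{\rho}l\mp\frac{c_5}{\rho}il\mp\frac{c_6}{\rho}jl\mp\frac{c_7}{\rho}kl,$$ (all upper signs or all lower signs), where $c=c_0+c_1i+c_2j+c_3k+c_4l+c_5il+c_6jl+c_7kl$ with $c_0,\dots,c_7\in\mathbb{R}$ and $$\rho=\sqrt{\left(b^2-4c_0+\sqrt{(b^2-4c_0)^2+16(c_1^2+c_2^2+c_3^2+c_4^2+c_5^2+c_6^2+c_7^2)}\right)\Big/2}.$$ Case 4. If $b\notin\mathbb{R}$, then $$x=\frac{-\operatorname{Re} b}{2}-(b'+T)^{-1}(c'-N),$$ where $b'=b-\operatorname{Re} b=\operatorname{Im}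 b$, $c'=c-\frac{\operatorname{Re} b}{2}\left(b-\frac{\operatorname{Re} b}{2}\right)$, and, with the real numbers $$B=b'\overline{b'}+c'+\overline{c'}=|b'|^2+2\operatorname{Re} c',\qquad E=c'\overline{c'}=|c'|^2,\qquad D=\overline{b'}c'+\overline{c'}b'=2\operatorname{Re}(\overline{b'}c'),$$ the pair $(T,N)$ is chosen as follows: 1. $T=0$, $N=(B\pm\sqrt{B^2-4E})/2$, provided that $D=0$ and $B^2\ge 4E$; 2. $T=\pm\sqrt{2\sqrt{E}-B}$, $N=\sqrt{E}$, provided that $D=0$ and $B^2<4E$; 3. $T=\pm\sqrt{z}$, $N=(T^3+BT+D)/(2T)$, provided that $D\neq 0$, where $z$ is the unique positive root of the real polynomial $z^3+2Bz^2+(B^2-4E)z-D^2$.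
   Context: $\mathbb{O}$ denotes the (real, 8-dimensional, non-commutative and non-associative) normed division algebra of octonions, $\mathbb{O}=\mathbb{H}\oplus\mathbb{H}\,l$, with real basis $1,i,j,k,l,il,jl,kl$; the seven non-real basis elements are imaginary units squaring to $-1$ that pairwise anticommute, $i,j,k$ multiply as in the quaternions $\mathbb{H}$, and for instance $(ij)l=kl$ while $i(jl)=-kl$. $\mathbb{R}$ is identified with the real multiples of $1$. The conjugate $\bar{x}$ is the real linear map fixing $1$ and changing the sign of each imaginary unit; $\operatorname{Re}x=(x+\bar{x})/2$, $\operatorname{Im}x=(x-\bar{x})/2$, $|x|^2=x\bar{x}$, and $x^{-1}=\bar{x}/|x|^2$ for $x\ne 0$. *)

theory Defs
  imports "HOL-Analysis.Inner_Product"
begin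

section \<open>Quaternions\<close>

codatatype quat = Quat (Q1: real) (Qi: real) (Qj: real) (Qk: real)

lemma quat_eq_iff: "x = y \<longleftrightarrow> Q1 x = Q1 y \<and> Qi x = Qi y \<and> Qj x = Qj y \<and> Qk x = Qk y"
  by (auto intro: quat.expand)

instantiation quat :: real_algebra_1
begin

primcorec zero_quat where
  "Q1 0 = 0" | "Qi 0 = 0" | "Qj 0 = 0" | "Qk 0 = 0"

primcorec one_quat where
  "Q1 1 = 1" | "Qi 1 = 0" | "Qj 1 = 0" | "Qk 1 = 0"

primcorec plus_quat where
  "Q1 (x + y) = Q1 x + Q1 y"
| "Qi (x + y) = Qi x + Qi y"
| "Qj (x + y) = Qj x + Qj y"
| "Qk (x + y) = Qk x + Qk y"

primcorec uminus_quat where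
  "Q1 (- x) = - Q1 x"
| "Qi (- x) = - Qi x"
| "Qj (- x) = - Qj x"
| "Qk (- x) = - Qk x"

primcorec minus_quat where
  "Q1 (x - y) = Q1 x - Q1 y"
| "Qi (x - y) = Qi x - Qi y"
| "Qj (x - y) = Qj x - Qj y"
| "Qk (x - y) = Qk x - Qk y"

primcorec scaleR_quat where
  "Q1 (r *\<^sub>R x) = r * Q1 x"
| "Qi (r *\<^sub>R x) = r * Qi x"
| "Qj (r *\<^sub>R x) = r * Qj x"
| "Qk (r *\<^sub>R x) = r * Qk x"

primcorec times_quat where
  "Q1 (x * y) = Q1 x * Q1 y - Qi x * Qi y - Qj x * Qj y - Qk x * Qk y"
| "Qi (x * y) = Q1 x * Qi y + Qi x * Q1 y + Qj x * Qk y - Qk x * Qj y"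
| "Qj (x * y) = Q1 x * Qj y - Qi x * Qk y + Qj x * Q1 y + Qk x * Qi y"
| "Qk (x * y) = Q1 x * Qk y + Qi x * Qj y - Qj x * Qi y + Qk x * Q1 y"

instance
  by standard (simp_all add: quat_eq_iff algebra_simps)

end

primcorec cnj_quat :: "quat \<Rightarrow> quat" where
  "Q1 (cnj_quat x) = Q1 x"
| "Qi (cnj_quat x) = - Qi x"
| "Qj (cnj_quat x) = - Qj x"
| "Qk (cnj_quat x) = - Qk x"


section \<open>Octonions\<close>

text \<open>\<open>Oct p q\<close> stands for \<open>p + q l\<close>.\<close>

codatatype octonion = Oct (HL: quat) (HR: quat)

lemma octonion_eq_iff: "x = y \<longleftrightarrow> HL x = HL y \<and> HR x = HR y"
  by (auto intro: octonion.expand)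

instantiation octonion :: real_vector
begin

primcorec zero_octonion where
  "HL 0 = 0" | "HR 0 = 0"

primcorec plus_octonion where
  "HL (x + y) = HL x + HL y"
| "HR (x + y) = HR x + HR y"

primcorec uminus_octonion where
  "HL (- x) = - HL x"
| "HR (- x) = - HR x"

primcorec minus_octonion where
  "HL (x - y) = HL x - HL y"
| "HR (x - y) = HR x - HR y"

primcorec scaleR_octonion where
  "HL (r *\<^sub>R x) = r *\<^sub>R HL x"
| "HR (r *\<^sub>R x) = r *\<^sub>R HR x"

instance
  by standard (simp_all add: octonion_eq_iff algebra_simps)

end

text \<open>
  Cayley--Dickson product
  \<open>(p + q l) (r + s l) = (p r - cnj s q) + (s p + q cnj r) l\<close>.
  Multiplication is not associative, so the classes from \<open>semigroup_mult\<close> upwards do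
  not apply. The class \<open>power\<close> provides \<open>x ^ 2 = x * (x * 1)\<close>.
\<close>

instantiation octonion :: power
begin

primcorec one_octonion where
  "HL 1 = 1" | "HR 1 = 0"

primcorec times_octonion where
  "HL (x * y) = HL x * HL y - cnj_quat (HR y) * HR x"
| "HR (x * y) = HR y * HL x + HR x * cnj_quat (HL y)"

instance ..

end

lemmas octonion_component_simps = octonion_eq_iff quat_eq_iff

definition oct_of_real :: "real \<Rightarrow> octonion" where
  "oct_of_real r = r *\<^sub>R 1"

definition oct_Reals :: "octonion set" where
  "oct_Reals = range oct_of_real"

primcorec cnj_oct :: "octonion \<Rightarrow> octonion" where
  "HL (cnj_oct x) = cnj_quat (HL x)"
| "HR (cnj_oct x) = - HR x"

text \<open>The real part is taken as an element of \<^typ>\<open>real\<close>; see \<open>oct_of_real_Re_oct\<close> below.\<close>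

definition Re_oct :: "octonion \<Rightarrow> real" where
  "Re_oct x = Q1 (HL x)"

definition Im_oct :: "octonion \<Rightarrow> octonion" where
  "Im_oct x = (1/2) *\<^sub>R (x - cnj_oct x)"

definition oct_i :: octonion where "oct_i = Oct (Quat 0 1 0 0) 0"
definition oct_j :: octonion where "oct_j = Oct (Quat 0 0 1 0) 0"
definition oct_k :: octonion where "oct_k = Oct (Quat 0 0 0 1) 0"
definition oct_l :: octonion where "oct_l = Oct 0 1"

instantiation octonion :: real_inner
begin

definition inner_octonion :: "octonion \<Rightarrow> octonion \<Rightarrow> real" where
  "inner x y = Re_oct (x * cnj_oct y)"

definition norm_octonion :: "octonion \<Rightarrow> real" where
  "norm x = sqrt (inner x x)" for x :: octonion

definition sgn_octonion :: "octonion \<Rightarrow> octonion" where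
  "sgn x = x /\<^sub>R norm x" for x :: octonion

definition dist_octonion :: "octonion \<Rightarrow> octonion \<Rightarrow> real" where
  "dist x y = norm (x - y)" for x y :: octonion

definition uniformity_octonion :: "(octonion \<times> octonion) filter" where
  "uniformity_octonion = (INF e\<in>{0 <..}. principal {(x, y). dist x y < e})"

definition open_octonion :: "octonion set \<Rightarrow> bool" where
  "open_octonion U \<longleftrightarrow> (\<forall>x\<in>U. eventually (\<lambda>(x', y). x' = x \<longrightarrow> y \<in> U) uniformity)"

lemma inner_octonion_self:
  "inner x x = (Q1 (HL x))\<^sup>2 + (Qi (HL x))\<^sup>2 + (Qj (HL x))\<^sup>2 + (Qk (HL x))\<^sup>2
     + (Q1 (HR x))\<^sup>2 + (Qi (HR x))\<^sup>2 + (Qj (HR x))\<^sup>2 + (Qk (HR x))\<^sup>2" for x :: octonion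
  by (simp add: inner_octonion_def Re_oct_def power2_eq_square)

instance
proof
  fix x y z :: octonion and r :: real
  show "inner x y = inner y x"
    by (simp add: inner_octonion_def Re_oct_def)
  show "inner (x + y) z = inner x z + inner y z"
    by (simp add: inner_octonion_def Re_oct_def algebra_simps)
  show "inner (r *\<^sub>R x) y = r * inner x y"
    by (simp add: inner_octonion_def Re_oct_def algebra_simps)
  show "0 \<le> inner x x"
    by (simp add: inner_octonion_self)
  show "inner x x = 0 \<longleftrightarrow> x = 0"
    by (simp add: inner_octonion_self octonion_component_simps add_nonneg_eq_0_iff)
qed (rule norm_octonion_def sgn_octonion_def dist_octonion_def
      uniformity_octonion_def open_octonion_def)+

end

instantiation octonion :: inverse
begin

definition inverse_octonion :: "octonion \<Rightarrow> octonion" where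
  "inverse x = cnj_oct x /\<^sub>R (norm x)\<^sup>2" for x :: octonion

definition divide_octonion :: "octonion \<Rightarrow> octonion \<Rightarrow> octonion" where
  "x div y = x * inverse y" for x y :: octonion

instance ..

end

lemma oct_mult_1 [simp]: "1 * x = x" "x * 1 = x" for x :: octonion
  by (simp_all add: octonion_component_simps)

lemma oct_power2: "x\<^sup>2 = x * x" for x :: octonion
  by (simp add: numeral_2_eq_2)

lemma oct_of_real_Re_oct: "oct_of_real (Re_oct x) = (1/2) *\<^sub>R (x + cnj_oct x)"
  by (simp add: oct_of_real_def Re_oct_def octonion_component_simps)

lemma Im_oct_conv: "Im_oct x = x - oct_of_real (Re_oct x)"
  by (simp add: oct_of_real_def Re_oct_def Im_oct_def octonion_component_simps)

lemma oct_of_real_norm_sq: "oct_of_real ((norm x)\<^sup>2) = x * cnj_oct x"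
  by (simp add: oct_of_real_def norm_eq_sqrt_inner inner_octonion_self
      octonion_component_simps power2_eq_square)

lemma oct_inverse:
  fixes x :: octonion
  assumes "x \<noteq> 0"
  shows "x * inverse x = 1" and "inverse x * x = 1"
proof -
  have n: "(norm x)\<^sup>2 \<noteq> 0" using assms by simp
  have "x * cnj_oct x = (norm x)\<^sup>2 *\<^sub>R 1" "cnj_oct x * x = (norm x)\<^sup>2 *\<^sub>R 1"
    by (simp_all add: norm_eq_sqrt_inner inner_octonion_self
      octonion_component_simps power2_eq_square)
  moreover have "x * inverse x = (x * cnj_oct x) /\<^sub>R (norm x)\<^sup>2"
    and "inverse x * x = (cnj_oct x * x) /\<^sub>R (norm x)\<^sup>2"
    by (simp_all add: inverse_octonion_def octonion_component_simps algebra_simps)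
  ultimately show "x * inverse x = 1" "inverse x * x = 1" using n by simp_all
qed

lemma norm_mult_octonion: "norm (x * y) = norm x * norm y" for x y :: octonion
  unfolding norm_eq_sqrt_inner inner_octonion_self real_sqrt_mult [symmetric]
  by (rule arg_cong [where f = sqrt]) (simp add: power2_eq_square algebra_simps)

lemma oct_units:
  "oct_i * oct_j = oct_k" "oct_j * oct_k = oct_i" "oct_k * oct_i = oct_j"
  "(oct_i * oct_j) * oct_l = oct_k * oct_l" "oct_i * (oct_j * oct_l) = - (oct_k * oct_l)"
  by (simp_all add: oct_i_def oct_j_def oct_k_def oct_l_def octonion_component_simps)

lemma oct_units_anticommute:
  defines "U \<equiv> [oct_i, oct_j, oct_k, oct_l, oct_i * oct_l, oct_j * oct_l, oct_k * oct_l]"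
  assumes "m < 7" "n < 7"
  shows "U ! m * U ! m = - 1" and "m \<noteq> n \<Longrightarrow> U ! m * U ! n = - (U ! n * U ! m)"
    and "cnj_oct (U ! m) = - (U ! m)"
proof -
  have *: "m \<in> {0,1,2,3,4,5,6}" "n \<in> {0,1,2,3,4,5,6}" using assms(2,3) by auto
  note s = oct_i_def oct_j_def oct_k_def oct_l_def octonion_component_simps
  show "U ! m * U ! m = - 1" and "cnj_oct (U ! m) = - (U ! m)"
    using * by (auto simp: U_def s)
  show "U ! m * U ! n = - (U ! n * U ! m)" if "m \<noteq> n"
    using * that by (auto simp: U_def s)
qed

lemma oct_basis_expansion:
  "\<exists>!(c0, c1, c2, c3, c4, c5, c6, c7).
     c = c0 *\<^sub>R 1 + c1 *\<^sub>R oct_i + c2 *\<^sub>R oct_j + c3 *\<^sub>R oct_k + c4 *\<^sub>R oct_l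
       + c5 *\<^sub>R (oct_i * oct_l) + c6 *\<^sub>R (oct_j * oct_l) + c7 *\<^sub>R (oct_k * oct_l)"
  by (rule ex1I [of _ "(Q1 (HL c), Qi (HL c), Qj (HL c), Qk (HL c),
        Q1 (HR c), Qi (HR c), Qj (HR c), Qk (HR c))"])
     (auto simp: oct_i_def oct_j_def oct_k_def oct_l_def octonion_component_simps)

definition oct_left_quadratic_solutions :: "octonion \<Rightarrow> octonion \<Rightarrow> octonion set" where
  "oct_left_quadratic_solutions b c = {x. x\<^sup>2 + b * x + c = 0}"

end

(*
  Every octonion satisfies x^2 = 2 Re(x) x - |x|^2. In case 4 the shift y = x + Re b / 2 leads to
  y^2 + b' y + c' = 0, which for T = 2 Re y and N = |y|^2 becomes the linear equation
  (b' + T) y = N - c'. It has a unique solution since b' + T is invertible and the octonions are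
  alternative. This y has 2 Re y = T and |y|^2 = N iff
    N^2 - (B + T^2) N + E = 0  and  T^3 + (B - 2 N) T + D = 0,
  and this real system is solved with the help of B > - 2 sqrt E. For real b, completing the
  square gives (2 x + b)^2 = b^2 - 4 c, and square roots are computed from their real and
  imaginary parts.
*)
theory Submission
  imports Defs
begin

section \<open>Octonion arithmetic\<close>

lemma oct_of_real_simps [simp]:
  "Q1 (HL (oct_of_real r)) = r" "Qi (HL (oct_of_real r)) = 0"
  "Qj (HL (oct_of_real r)) = 0" "Qk (HL (oct_of_real r)) = 0" "HR (oct_of_real r) = 0"
  by (simp_all add: oct_of_real_def)

lemma oct_distrib:
  fixes x y z :: octonion
  shows "(x + y) * z = x * z + y * z" "x * (y + z) = x * y + x * z"
    "(x - y) * z = x * z - y * z" "x * (y - z) = x * y - x * z"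
    "(r *\<^sub>R x) * y = r *\<^sub>R (x * y)" "x * (r *\<^sub>R y) = r *\<^sub>R (x * y)"
    "(- x) * y = - (x * y)" "x * (- y) = - (x * y)"
  by (simp_all add: octonion_component_simps algebra_simps)

lemma oct_of_real_mult:
  "oct_of_real r * x = r *\<^sub>R x" "x * oct_of_real r = r *\<^sub>R x"
  by (simp_all add: octonion_component_simps)

lemma Re_oct_simps [simp]:
  "Re_oct (x + y) = Re_oct x + Re_oct y" "Re_oct (x - y) = Re_oct x - Re_oct y"
  "Re_oct (- x) = - Re_oct x" "Re_oct (r *\<^sub>R x) = r * Re_oct x"
  "Re_oct (oct_of_real r) = r" "Re_oct (cnj_oct x) = Re_oct x" "Re_oct (Im_oct x) = 0"
  "Re_oct 0 = 0"
  by (simp_all add: Re_oct_def Im_oct_def)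

lemma Im_oct_0 [simp]: "Im_oct 0 = 0"
  by (simp add: Im_oct_def octonion_component_simps)

lemma norm_octonion_squared:
  "(norm x)\<^sup>2 = (Q1 (HL x))\<^sup>2 + (Qi (HL x))\<^sup>2 + (Qj (HL x))\<^sup>2 + (Qk (HL x))\<^sup>2
     + (Q1 (HR x))\<^sup>2 + (Qi (HR x))\<^sup>2 + (Qj (HR x))\<^sup>2 + (Qk (HR x))\<^sup>2" for x :: octonion
  by (simp add: power2_norm_eq_inner inner_octonion_self)

lemma abs_Re_oct_le_norm: "\<bar>Re_oct x\<bar> \<le> norm x"
  by (rule power2_le_imp_le)
    (simp_all add: norm_octonion_squared Re_oct_def)

text \<open>Every octonion is a root of its own quadratic polynomial with trace
  \<open>2 * Re_oct x\<close> and norm \<open>(norm x)\<^sup>2\<close>. Once these two reals are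
  fixed, a quadratic equation in x becomes linear.\<close>

lemma oct_square: "x * x = (2 * Re_oct x) *\<^sub>R x - oct_of_real ((norm x)\<^sup>2)"
  unfolding norm_octonion_squared Re_oct_def
  by (simp add: octonion_component_simps algebra_simps power2_eq_square)

lemma oct_of_real_Re_Im: "oct_of_real (Re_oct x) + Im_oct x = x"
  by (simp add: Im_oct_conv)

lemma oct_eq_iff_Re_Im: "x = y \<longleftrightarrow> Re_oct x = Re_oct y \<and> Im_oct x = Im_oct y"
  by (metis oct_of_real_Re_Im)

lemma Im_oct_eq_0_iff: "Im_oct x = 0 \<longleftrightarrow> x \<in> oct_Reals"
  unfolding oct_Reals_def Im_oct_conv by (auto simp: image_iff)

lemma oct_of_real_Re: "x \<in> oct_Reals \<Longrightarrow> oct_of_real (Re_oct x) = x"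
  by (auto simp: oct_Reals_def)

text \<open>This replaces associativity: the conjugate of x lies in the real span of 1 and x, so
  alternativity allows the brackets to be moved.\<close>

lemma cnj_oct_mult_cancel:
  "cnj_oct x * (x * y) = (norm x)\<^sup>2 *\<^sub>R y" "x * (cnj_oct x * y) = (norm x)\<^sup>2 *\<^sub>R y"
  unfolding norm_octonion_squared
  by (simp_all add: octonion_component_simps algebra_simps power2_eq_square)

text \<open>Left multiplication by a nonzero x is thus bijective, so equations
  \<open>x * y = w\<close> can be solved for y as in an associative division ring.\<close>

lemma inverse_oct_mult_cancel:
  fixes x y :: octonion
  assumes "x \<noteq> 0"
  shows "inverse x * (x * y) = y" "x * (inverse x * y) = y"
  using assms by (simp_all add: inverse_octonion_def oct_distrib cnj_oct_mult_cancel)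

lemma oct_basis_sum:
  "c0 *\<^sub>R 1 + c1 *\<^sub>R oct_i + c2 *\<^sub>R oct_j + c3 *\<^sub>R oct_k + c4 *\<^sub>R oct_l
     + c5 *\<^sub>R (oct_i * oct_l) + c6 *\<^sub>R (oct_j * oct_l) + c7 *\<^sub>R (oct_k * oct_l)
   = Oct (Quat c0 c1 c2 c3) (Quat c4 c5 c6 c7)"
  by (simp add: oct_i_def oct_j_def oct_k_def oct_l_def octonion_component_simps)

lemma oct_square_Re_Im:
  "Re_oct (x * x) = (Re_oct x)\<^sup>2 - (norm (Im_oct x))\<^sup>2"
  "Im_oct (x * x) = (2 * Re_oct x) *\<^sub>R Im_oct x"
  unfolding norm_octonion_squared
  by (simp_all add: Re_oct_def Im_oct_def octonion_component_simps power2_eq_square)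

section \<open>Real linear coefficient\<close>

text \<open>A real r commutes with x, so the equation is (2 x + r)^2 = r^2 - 4 c. Here 2 x + r has
  real part \<open>2 * Re_oct x + r\<close> and imaginary part \<open>2 *\<^sub>R Im_oct x\<close>;
  the imaginary equation has been divided by 4.\<close>

lemma left_quadratic_real_iff:
  "x \<in> oct_left_quadratic_solutions (oct_of_real r) c \<longleftrightarrow>
     (2 * Re_oct x + r)\<^sup>2 - (norm (2 *\<^sub>R Im_oct x))\<^sup>2 = r\<^sup>2 - 4 * Re_oct c \<and>
     (2 * Re_oct x + r) *\<^sub>R Im_oct x = - Im_oct c"
proof -
  have "x \<in> oct_left_quadratic_solutions (oct_of_real r) c \<longleftrightarrow>
      Re_oct (x * x + oct_of_real r * x + c) = 0 \<and> Im_oct (x * x + oct_of_real r * x + c) = 0"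
    by (simp add: oct_left_quadratic_solutions_def oct_power2
        oct_eq_iff_Re_Im [of "x * x + oct_of_real r * x + c" 0])
  also have "Im_oct (x * x + oct_of_real r * x + c) = (2 * Re_oct x + r) *\<^sub>R Im_oct x + Im_oct c"
    by (simp add: Im_oct_conv oct_square oct_of_real_mult)
       (simp add: octonion_component_simps algebra_simps Re_oct_def)
  finally show ?thesis
    by (auto simp: oct_of_real_mult oct_square_Re_Im eq_neg_iff_add_eq_0 power_mult_distrib
        power2_eq_square algebra_simps)
qed

lemma quadratic_factor:
  fixes s p q x :: real
  assumes "s\<^sup>2 = p\<^sup>2 - 4 * q"
  shows "x\<^sup>2 - p * x + q = (x - (p + s) / 2) * (x - (p - s) / 2)"
proof -
  have "x - (p + s) / 2 = (2 * x - (p + s)) / 2" "x - (p - s) / 2 = (2 * x - (p - s)) / 2"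
    by (simp_all add: diff_divide_distrib)
  then have "4 * ((x - (p + s) / 2) * (x - (p - s) / 2)) = (2 * x - (p + s)) * (2 * x - (p - s))"
    by (simp only: times_divide_times_eq)
  also have "\<dots> = 4 * x\<^sup>2 - 4 * p * x + (p\<^sup>2 - s\<^sup>2)"
    by (simp add: algebra_simps power2_eq_square)
  finally show ?thesis using assms by simp
qed

text \<open>Multiplying by t^2 gives a quadratic in t^2 whose roots have product - m < 0, so exactly
  one of them is a possible value of t^2. The conjunct \<open>t \<noteq> 0\<close> cannot be
  dropped: division by zero yields 0, so t = 0 would satisfy the equation when d = 0.\<close>

lemma square_diff_quotient_iff:
  fixes t d m :: real
  assumes "m > 0"
  defines "\<rho> \<equiv> sqrt ((d + sqrt (d\<^sup>2 + 4 * m)) / 2)"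
  shows "\<rho> > 0" "t\<^sup>2 - m / t\<^sup>2 = d \<and> t \<noteq> 0 \<longleftrightarrow> t = \<rho> \<or> t = - \<rho>"
proof -
  define s where "s = sqrt (d\<^sup>2 + 4 * m)"
  have s2: "s\<^sup>2 = d\<^sup>2 + 4 * m"
    unfolding s_def using assms(1) by simp
  have s: "s > \<bar>d\<bar>"
    unfolding s_def using assms(1) by (intro real_less_rsqrt) simp
  then show "\<rho> > 0"
    unfolding \<rho>_def s_def [symmetric] by simp
  have \<rho>2: "\<rho>\<^sup>2 = (d + s) / 2"
    unfolding \<rho>_def s_def [symmetric] using s by simp
  have "t\<^sup>2 - m / t\<^sup>2 = d \<longleftrightarrow> t\<^sup>2 = (d + s) / 2" if "t \<noteq> 0"
  proof -
    have t: "t\<^sup>2 > 0" using that by simp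
    have "t\<^sup>2 - m / t\<^sup>2 = d \<longleftrightarrow> t\<^sup>2 * t\<^sup>2 - d * t\<^sup>2 - m = 0"
      using t by (simp add: field_simps)
    also have "t\<^sup>2 * t\<^sup>2 - d * t\<^sup>2 - m = (t\<^sup>2 - (d + s) / 2) * (t\<^sup>2 - (d - s) / 2)"
      using quadratic_factor [of s d "- m" "t\<^sup>2"] s2 by (simp add: power2_eq_square)
    finally have "t\<^sup>2 - m / t\<^sup>2 = d \<longleftrightarrow> t\<^sup>2 = (d + s) / 2 \<or> t\<^sup>2 = (d - s) / 2"
      by (simp only: mult_eq_0_iff right_minus_eq)
    moreover have "(d - s) / 2 < 0"
      using s by simp
    then have "t\<^sup>2 \<noteq> (d - s) / 2"
      using t by linarith
    ultimately show ?thesis by auto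
  qed
  then have "t\<^sup>2 - m / t\<^sup>2 = d \<and> t \<noteq> 0 \<longleftrightarrow> t\<^sup>2 = \<rho>\<^sup>2 \<and> t \<noteq> 0"
    using \<rho>2 by auto
  then show "t\<^sup>2 - m / t\<^sup>2 = d \<and> t \<noteq> 0 \<longleftrightarrow> t = \<rho> \<or> t = - \<rho>"
    using \<open>\<rho> > 0\<close> by (auto simp: power2_eq_iff)
qed

lemma left_quadratic_real_nonneg:
  assumes "r\<^sup>2 \<ge> 4 * c"
  shows "oct_left_quadratic_solutions (oct_of_real r) (oct_of_real c) =
    {oct_of_real ((- r + sqrt (r\<^sup>2 - 4 * c)) / 2), oct_of_real ((- r - sqrt (r\<^sup>2 - 4 * c)) / 2)}"
proof -
  let ?s = "sqrt (r\<^sup>2 - 4 * c)"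
  have "x \<in> oct_left_quadratic_solutions (oct_of_real r) (oct_of_real c) \<longleftrightarrow>
      x = oct_of_real ((- r + ?s) / 2) \<or> x = oct_of_real ((- r - ?s) / 2)" for x
  proof -
    have "x \<in> oct_left_quadratic_solutions (oct_of_real r) (oct_of_real c) \<longleftrightarrow>
        (2 * Re_oct x + r)\<^sup>2 - (norm (2 *\<^sub>R Im_oct x))\<^sup>2 = ?s\<^sup>2 \<and>
        (2 * Re_oct x + r) *\<^sub>R Im_oct x = 0"
      using assms by (simp add: left_quadratic_real_iff Im_oct_conv)
    \<comment> \<open>If \<open>2 * Re_oct x + r\<close> vanishes, the first equation says that two
      squares sum to zero, so the imaginary part vanishes in either case.\<close>
    also have "\<dots> \<longleftrightarrow> (2 * Re_oct x + r)\<^sup>2 = ?s\<^sup>2 \<and> Im_oct x = 0"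
      using sum_power2_eq_zero_iff[of ?s "norm (2 *\<^sub>R Im_oct x)"] by auto
    also have "\<dots> \<longleftrightarrow> (Re_oct x = (- r + ?s) / 2 \<or> Re_oct x = (- r - ?s) / 2) \<and> Im_oct x = 0"
      by (auto simp: power2_eq_iff)
    also have "\<dots> \<longleftrightarrow> x = oct_of_real ((- r + ?s) / 2) \<or> x = oct_of_real ((- r - ?s) / 2)"
      unfolding oct_eq_iff_Re_Im [of x] by (auto simp: Im_oct_conv [of "oct_of_real _"])
    finally show ?thesis .
  qed
  then show ?thesis by blast
qed

text \<open>\<open>Im_oct x = 0\<close> would make a real square equal to the negative discriminant.
  What remains is \<open>2 * Re_oct x + r = 0\<close>, which leaves the direction of the imaginary
  part free: a six-dimensional sphere of solutions.\<close>

lemma left_quadratic_real_neg: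
  assumes "r\<^sup>2 < 4 * c"
  shows "x \<in> oct_left_quadratic_solutions (oct_of_real r) (oct_of_real c) \<longleftrightarrow>
    2 * Re_oct x = - r \<and> (norm (2 *\<^sub>R Im_oct x))\<^sup>2 = 4 * c - r\<^sup>2"
proof -
  have "x \<in> oct_left_quadratic_solutions (oct_of_real r) (oct_of_real c) \<longleftrightarrow>
      (2 * Re_oct x + r)\<^sup>2 - (norm (2 *\<^sub>R Im_oct x))\<^sup>2 = r\<^sup>2 - 4 * c \<and>
      (2 * Re_oct x + r = 0 \<or> Im_oct x = 0)"
    by (simp add: left_quadratic_real_iff Im_oct_conv [of "oct_of_real c"])
  also have "\<dots> \<longleftrightarrow> 2 * Re_oct x + r = 0 \<and> (norm (2 *\<^sub>R Im_oct x))\<^sup>2 = 4 * c - r\<^sup>2"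
  proof -
    have "(2 * Re_oct x + r)\<^sup>2 \<noteq> r\<^sup>2 - 4 * c"
      using assms zero_le_power2 [of "2 * Re_oct x + r"] by linarith
    then show ?thesis by auto
  qed
  finally show ?thesis by auto
qed

text \<open>As Im c is nonzero, t = 2 Re x + r is nonzero and forces Im x = - Im c / t. The real
  part is then an equation in t alone, with two roots of opposite sign.\<close>

lemma left_quadratic_real_nonreal:
  fixes c :: octonion and r :: real
  assumes "c \<notin> oct_Reals"
  defines "d \<equiv> r\<^sup>2 - 4 * Re_oct c"
  defines "\<rho> \<equiv> sqrt ((d + sqrt (d\<^sup>2 + 16 * (norm (Im_oct c))\<^sup>2)) / 2)"
  shows "oct_left_quadratic_solutions (oct_of_real r) c =
    {oct_of_real ((- r + \<rho>) / 2) - (1 / \<rho>) *\<^sub>R Im_oct c,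
     oct_of_real ((- r - \<rho>) / 2) + (1 / \<rho>) *\<^sub>R Im_oct c}"
proof -
  \<comment> \<open>The value that makes |2 Im x|^2 equal to \<open>m / t\<^sup>2\<close> when Im x
    = - Im c / t.\<close>
  define m where "m = 4 * (norm (Im_oct c))\<^sup>2"
  have m: "m > 0" using assms(1) by (simp add: m_def Im_oct_eq_0_iff)
  have \<rho>: "\<rho> = sqrt ((d + sqrt (d\<^sup>2 + 4 * m)) / 2)" by (simp add: \<rho>_def m_def)
  note roots = square_diff_quotient_iff [OF m, where d = d, folded \<rho>]
  have "x \<in> oct_left_quadratic_solutions (oct_of_real r) c \<longleftrightarrow>
      x = oct_of_real ((- r + \<rho>) / 2) - (1 / \<rho>) *\<^sub>R Im_oct c \<or>
      x = oct_of_real ((- r - \<rho>) / 2) + (1 / \<rho>) *\<^sub>R Im_oct c" for x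
  proof -
    define t where "t = 2 * Re_oct x + r"
    have "x \<in> oct_left_quadratic_solutions (oct_of_real r) c \<longleftrightarrow>
        t\<^sup>2 - (norm (2 *\<^sub>R Im_oct x))\<^sup>2 = d \<and> t *\<^sub>R Im_oct x = - Im_oct c"
      by (simp add: left_quadratic_real_iff t_def d_def)
    also have "t *\<^sub>R Im_oct x = - Im_oct c \<longleftrightarrow> t \<noteq> 0 \<and> Im_oct x = - (1 / t) *\<^sub>R Im_oct c"
    proof (cases "t = 0")
      case True
      then show ?thesis using assms(1) by (simp add: Im_oct_eq_0_iff)
    next
      case False
      then have "Im_oct x = (1 / t) *\<^sub>R (t *\<^sub>R Im_oct x)" by simp
      then have "Im_oct x = - (1 / t) *\<^sub>R Im_oct c" if "t *\<^sub>R Im_oct x = - Im_oct c"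
        using that by simp
      with False show ?thesis by auto
    qed
    also have "t\<^sup>2 - (norm (2 *\<^sub>R Im_oct x))\<^sup>2 = d \<and> t \<noteq> 0 \<and> Im_oct x = - (1 / t) *\<^sub>R Im_oct c
        \<longleftrightarrow> (t\<^sup>2 - m / t\<^sup>2 = d \<and> t \<noteq> 0) \<and> Im_oct x = - (1 / t) *\<^sub>R Im_oct c"
      by (auto simp: m_def power_mult_distrib power_divide)
    also have "\<dots> \<longleftrightarrow> (t = \<rho> \<or> t = - \<rho>) \<and> Im_oct x = - (1 / t) *\<^sub>R Im_oct c"
      by (simp only: roots(2))
    also have "\<dots> \<longleftrightarrow> t = \<rho> \<and> Im_oct x = - (1 / \<rho>) *\<^sub>R Im_oct c \<or>
        t = - \<rho> \<and> Im_oct x = (1 / \<rho>) *\<^sub>R Im_oct c"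
      by auto
    also have "\<dots> \<longleftrightarrow> Re_oct x = (- r + \<rho>) / 2 \<and> Im_oct x = - (1 / \<rho>) *\<^sub>R Im_oct c \<or>
        Re_oct x = (- r - \<rho>) / 2 \<and> Im_oct x = (1 / \<rho>) *\<^sub>R Im_oct c"
      by (auto simp: t_def)
    also have "\<dots> \<longleftrightarrow> x = oct_of_real ((- r + \<rho>) / 2) - (1 / \<rho>) *\<^sub>R Im_oct c \<or>
        x = oct_of_real ((- r - \<rho>) / 2) + (1 / \<rho>) *\<^sub>R Im_oct c"
      unfolding oct_eq_iff_Re_Im [of x] by (simp add: Im_oct_conv)
    finally show ?thesis .
  qed
  then show ?thesis by blast
qed

section \<open>Nonreal linear coefficient\<close>

text \<open>T and N enter the candidate y as parameters; the real system decides whether they are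
  its actual trace and norm. With a = b + T and w = c - N one has \<open>a * y = - w\<close>.
  Multiplicativity of the norm gives the first equation, and the real part of
  \<open>cnj_oct a * (a * y)\<close> gives the second.\<close>

lemma inverse_oct_Re_norm:
  fixes b c :: octonion and T N :: real
  assumes "Re_oct b = 0" "b \<noteq> 0"
  defines "B \<equiv> (norm b)\<^sup>2 + 2 * Re_oct c" and "E \<equiv> (norm c)\<^sup>2"
    and "D \<equiv> 2 * Re_oct (cnj_oct b * c)"
    and "y \<equiv> - (inverse (b + oct_of_real T) * (c - oct_of_real N))"
  shows "2 * Re_oct y = T \<and> (norm y)\<^sup>2 = N \<longleftrightarrow>
    N\<^sup>2 - (B + T\<^sup>2) * N + E = 0 \<and> T^3 + (B - 2 * N) * T + D = 0"
proof -
  define a where "a = b + oct_of_real T"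
  define w where "w = c - oct_of_real N"
  \<comment> \<open>There is no mixed term because b is purely imaginary.\<close>
  have na: "(norm a)\<^sup>2 = (norm b)\<^sup>2 + T\<^sup>2"
    using assms(1) by (simp add: a_def norm_octonion_squared Re_oct_def)
  have pos: "(norm a)\<^sup>2 > 0"
    using assms(2) by (simp add: na add_pos_nonneg)
  then have a0: "a \<noteq> 0" by auto
  have y: "y = - (inverse a * w)" by (simp add: y_def a_def w_def)
  then have ay: "a * y = - w"
    using a0 by (simp add: oct_distrib inverse_oct_mult_cancel)
  then have "norm a * norm y = norm w"
    by (metis norm_mult_octonion norm_minus_cancel)
  then have "(norm a)\<^sup>2 * (norm y)\<^sup>2 = (norm w)\<^sup>2"
    by (metis power_mult_distrib)
  moreover have "(norm w)\<^sup>2 = E - 2 * N * Re_oct c + N\<^sup>2"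
    unfolding E_def w_def norm_octonion_squared Re_oct_def
    by (simp add: power2_eq_square algebra_simps)
  ultimately have "(norm y)\<^sup>2 = (E - 2 * N * Re_oct c + N\<^sup>2) / (norm a)\<^sup>2"
    using pos by (simp add: field_simps)
  then have "(norm y)\<^sup>2 = N \<longleftrightarrow> E - 2 * N * Re_oct c + N\<^sup>2 = N * (norm a)\<^sup>2"
    using pos by (simp only: divide_eq_eq) simp
  then have 1: "(norm y)\<^sup>2 = N \<longleftrightarrow> N\<^sup>2 - (B + T\<^sup>2) * N + E = 0"
    by (auto simp: na B_def algebra_simps)
  \<comment> \<open>Multiplying by the conjugate isolates y up to a positive real factor, so its
    real part can be read off from w.\<close>
  have "(norm a)\<^sup>2 *\<^sub>R y = cnj_oct a * (a * y)"
    by (simp add: cnj_oct_mult_cancel)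
  then have "(norm a)\<^sup>2 * Re_oct y = Re_oct (cnj_oct a * (- w))"
    by (metis Re_oct_simps(4) ay)
  then have "(norm a)\<^sup>2 * (2 * Re_oct y) = - 2 * T * Re_oct c + 2 * T * N - D"
    using assms(1) by (simp add: a_def w_def D_def Re_oct_def algebra_simps)
  then have "2 * Re_oct y = (- 2 * T * Re_oct c + 2 * T * N - D) / (norm a)\<^sup>2"
    using pos by (simp add: field_simps)
  then have "2 * Re_oct y = T \<longleftrightarrow> - 2 * T * Re_oct c + 2 * T * N - D = T * (norm a)\<^sup>2"
    using pos by (simp only: divide_eq_eq) simp
  then have 2: "2 * Re_oct y = T \<longleftrightarrow> T^3 + (B - 2 * N) * T + D = 0"
    unfolding na B_def by (auto simp: algebra_simps power3_eq_cube power2_eq_square)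
  show ?thesis using 1 2 by blast
qed

text \<open>When T and N are the trace and norm of y, the quadratic equation for y coincides with a
  linear one whose only solution is the candidate. A solution supplies T and N itself; conversely,
  the real system guarantees that the candidate has the prescribed trace and norm.\<close>

lemma imaginary_left_quadratic_iff:
  fixes b c y :: octonion
  assumes "Re_oct b = 0" "b \<noteq> 0"
  defines "B \<equiv> (norm b)\<^sup>2 + 2 * Re_oct c" and "E \<equiv> (norm c)\<^sup>2"
    and "D \<equiv> 2 * Re_oct (cnj_oct b * c)"
  shows "y * y + b * y + c = 0 \<longleftrightarrow>
    (\<exists>T N. (N\<^sup>2 - (B + T\<^sup>2) * N + E = 0 \<and> T^3 + (B - 2 * N) * T + D = 0) \<and>
      y = - (inverse (b + oct_of_real T) * (c - oct_of_real N)))"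
    (is "_ \<longleftrightarrow> (\<exists>T N. ?P T N \<and> y = ?y T N)")
proof -
  have nz: "b + oct_of_real T \<noteq> 0" for T
  proof
    assume eq: "b + oct_of_real T = 0"
    then have "Re_oct (b + oct_of_real T) = 0" by (simp add: Re_oct_def)
    with assms(1) have "T = 0" by simp
    with eq assms(2) show False by (simp add: oct_of_real_def)
  qed
  have sol: "y * y + b * y + c = 0 \<longleftrightarrow> y = ?y T N"
    if "2 * Re_oct y = T" "(norm y)\<^sup>2 = N" for T N
  proof -
    have "y * y + b * y + c = (b + oct_of_real T) * y + (c - oct_of_real N)"
      by (simp add: oct_square that oct_distrib oct_of_real_mult)
    then have "y * y + b * y + c = 0 \<longleftrightarrow> (b + oct_of_real T) * y = - (c - oct_of_real N)"
      by (simp only: eq_neg_iff_add_eq_0)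
    also have "\<dots> \<longleftrightarrow> y = ?y T N"
      using inverse_oct_mult_cancel [OF nz [of T]] by (metis oct_distrib(8))
    finally show ?thesis .
  qed
  note P_iff = inverse_oct_Re_norm [OF assms(1,2), where c = c, folded B_def E_def D_def]
  show ?thesis
  proof
    assume "y * y + b * y + c = 0"
    then have "y = ?y (2 * Re_oct y) ((norm y)\<^sup>2)" using sol [OF refl refl] by simp
    moreover from this have "?P (2 * Re_oct y) ((norm y)\<^sup>2)" using P_iff by metis
    ultimately show "\<exists>T N. ?P T N \<and> y = ?y T N" by blast
  next
    assume "\<exists>T N. ?P T N \<and> y = ?y T N"
    then obtain T N where TN: "?P T N" "y = ?y T N" by blast
    then have "2 * Re_oct y = T" "(norm y)\<^sup>2 = N" using P_iff [of T N] by simp_all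
    then show "y * y + b * y + c = 0" using sol TN(2) by simp
  qed
qed

text \<open>The real part of b is central, so with r = Re b / 2 the shift by r absorbs it as in the
  commutative case. The shift creates the extra constant r^2 + r Im b = r (b - r), which is
  subtracted from c.\<close>

lemma left_quadratic_iff_shifted:
  fixes b c x :: octonion
  shows "x \<in> oct_left_quadratic_solutions b c \<longleftrightarrow>
    (let y = x + oct_of_real (Re_oct b / 2) in y * y + Im_oct b * y
       + (c - (Re_oct b / 2) *\<^sub>R (b - oct_of_real (Re_oct b / 2))) = 0)"
proof -
  define r where "r = Re_oct b / 2"
  have b: "b = oct_of_real (2 * r) + Im_oct b"
    by (simp add: r_def oct_of_real_Re_Im)
  have "x\<^sup>2 + b * x + c = (x + oct_of_real r) * (x + oct_of_real r)
      + Im_oct b * (x + oct_of_real r) + (c - r *\<^sub>R (b - oct_of_real r))"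
    \<comment> \<open>Only the occurrences of \<open>b\<close> outside \<open>Im_oct b\<close> are
      split into real and imaginary part.\<close>
    by (subst (1 3) b, simp add: oct_power2 oct_distrib oct_of_real_mult)
       (simp add: octonion_component_simps algebra_simps)
  then show ?thesis
    by (simp only: oct_left_quadratic_solutions_def mem_Collect_eq r_def Let_def)
qed

text \<open>After this reduction only real pairs (T, N) remain to be found.\<close>

lemma left_quadratic_nonreal:
  fixes b c :: octonion
  assumes "b \<notin> oct_Reals"
  defines "b' \<equiv> Im_oct b"
    and "c' \<equiv> c - (Re_oct b / 2) *\<^sub>R (b - oct_of_real (Re_oct b / 2))"
  defines "B \<equiv> (norm b')\<^sup>2 + 2 * Re_oct c'" and "E \<equiv> (norm c')\<^sup>2"
    and "D \<equiv> 2 * Re_oct (cnj_oct b' * c')"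
  shows "oct_left_quadratic_solutions b c =
    (\<lambda>(T, N). oct_of_real (- Re_oct b / 2)
        - inverse (b' + oct_of_real T) * (c' - oct_of_real N)) `
      {(T, N). N\<^sup>2 - (B + T\<^sup>2) * N + E = 0 \<and> T^3 + (B - 2 * N) * T + D = 0}"
proof -
  have b': "Re_oct b' = 0" "b' \<noteq> 0"
    using assms(1) by (simp_all add: b'_def Im_oct_eq_0_iff)
  have shift: "x + oct_of_real (Re_oct b / 2) = - u \<longleftrightarrow> x = oct_of_real (- Re_oct b / 2) - u" for x u
    by (simp add: oct_of_real_def eq_diff_eq eq_neg_iff_add_eq_0 ac_simps)
  have "x \<in> oct_left_quadratic_solutions b c \<longleftrightarrow>
      (\<exists>T N. (N\<^sup>2 - (B + T\<^sup>2) * N + E = 0 \<and> T^3 + (B - 2 * N) * T + D = 0) \<and>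
        x = oct_of_real (- Re_oct b / 2)
          - inverse (b' + oct_of_real T) * (c' - oct_of_real N))" for x
    using imaginary_left_quadratic_iff [OF b', of "x + oct_of_real (Re_oct b / 2)" c']
    unfolding left_quadratic_iff_shifted Let_def b'_def [symmetric] c'_def [symmetric]
      B_def [symmetric] E_def [symmetric] D_def [symmetric] shift .
  then show ?thesis by (auto simp: image_iff)
qed

section \<open>The real system for the trace and the norm\<close>

text \<open>These are the pairs for which X^2 - T X + N divides the real quartic X^4 + B X^2 + D X +
  E; the complementary factor is X^2 + T X + (B + T^2 - N).\<close>

definition trace_norm_pairs :: "real \<Rightarrow> real \<Rightarrow> real \<Rightarrow> (real \<times> real) set" where
  "trace_norm_pairs B E D =
     {(T, N). N\<^sup>2 - (B + T\<^sup>2) * N + E = 0 \<and> T^3 + (B - 2 * N) * T + D = 0}"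

text \<open>For D = 0 the second equation is T (T^2 + B - 2 N) = 0. A nonzero T would give N^2 = E
  and T^2 = 2 N - B, which is at most 0 since B is at least 2 sqrt E. So T = 0, and N is a root of
  X^2 - B X + E.\<close>

lemma trace_norm_pairs_real_norms:
  assumes "E \<ge> 0" "B > - 2 * sqrt E" "B\<^sup>2 \<ge> 4 * E"
  shows "trace_norm_pairs B E 0 =
    {(0, (B + sqrt (B\<^sup>2 - 4 * E)) / 2), (0, (B - sqrt (B\<^sup>2 - 4 * E)) / 2)}"
proof -
  let ?s = "sqrt (B\<^sup>2 - 4 * E)"
  \<comment> \<open>The discriminant condition only bounds |B| from below; the lower bound on B then
    excludes the negative sign.\<close>
  have "(2 * sqrt E)\<^sup>2 \<le> B\<^sup>2" using assms by (simp add: power_mult_distrib)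
  then have "2 * sqrt E \<le> \<bar>B\<bar>"
    using assms(1) by (metis abs_le_square_iff abs_of_nonneg mult_nonneg_nonneg real_sqrt_ge_zero
        zero_le_numeral)
  then have B: "B \<ge> 2 * sqrt E" using assms(2) by linarith
  have s2: "?s\<^sup>2 = B\<^sup>2 - 4 * E" using assms(3) by simp
  have "(T, N) \<in> trace_norm_pairs B E 0 \<longleftrightarrow> T = 0 \<and> (N = (B + ?s) / 2 \<or> N = (B - ?s) / 2)" for T N
  proof -
    have "T = 0" if "N\<^sup>2 - (B + T\<^sup>2) * N + E = 0" "T^3 + (B - 2 * N) * T = 0"
    proof (rule ccontr)
      assume T: "T \<noteq> 0"
      have "T * (T\<^sup>2 + B - 2 * N) = 0"
        using that(2) by (simp add: algebra_simps power3_eq_cube power2_eq_square)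
      then have T2: "T\<^sup>2 = 2 * N - B" using T by simp
      then have "B + T\<^sup>2 = 2 * N" by simp
      with that(1) have "N\<^sup>2 - 2 * N * N + E = 0" by simp
      then have "N\<^sup>2 = E" by (simp add: power2_eq_square)
      then have "N \<le> sqrt E" by (metis abs_ge_self real_sqrt_abs)
      then have "T\<^sup>2 \<le> 0" using T2 B by simp
      then show False using T by simp
    qed
    moreover have "N\<^sup>2 - B * N + E = (N - (B + ?s) / 2) * (N - (B - ?s) / 2)"
      by (rule quadratic_factor [OF s2])
    ultimately show ?thesis by (auto simp: trace_norm_pairs_def)
  qed
  then show ?thesis by auto
qed

text \<open>Now T = 0 is impossible, as X^2 - B X + E has no real root. Hence T^2 = 2 N - B and N^2
  = E, and the lower bound on B rules out N = - sqrt E, which would make T^2 negative.\<close>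

lemma trace_norm_pairs_complex_norms:
  assumes "E \<ge> 0" "B > - 2 * sqrt E" "B\<^sup>2 < 4 * E"
  shows "trace_norm_pairs B E 0 =
    {(sqrt (2 * sqrt E - B), sqrt E), (- sqrt (2 * sqrt E - B), sqrt E)}"
proof -
  let ?t = "sqrt (2 * sqrt E - B)"
  have "B\<^sup>2 < (2 * sqrt E)\<^sup>2" using assms by (simp add: power_mult_distrib)
  then have "B < 2 * sqrt E"
    using assms(1) by (intro power_less_imp_less_base [of B 2]) auto
  then have t: "?t > 0" "?t\<^sup>2 = 2 * sqrt E - B" by simp_all
  have "(T, N) \<in> trace_norm_pairs B E 0 \<longleftrightarrow> (T = ?t \<or> T = - ?t) \<and> N = sqrt E" for T N
  proof
    assume "(T, N) \<in> trace_norm_pairs B E 0"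
    then have eqs: "N\<^sup>2 - (B + T\<^sup>2) * N + E = 0" "T * (T\<^sup>2 + B - 2 * N) = 0"
      by (simp_all add: trace_norm_pairs_def algebra_simps power3_eq_cube power2_eq_square)
    have "T \<noteq> 0"
    proof
      assume "T = 0"
      then have "(2 * N - B)\<^sup>2 = B\<^sup>2 - 4 * E"
        using eqs(1) by (simp add: algebra_simps power2_eq_square)
      then show False using assms(3) zero_le_power2 [of "2 * N - B"] by linarith
    qed
    then have T2: "T\<^sup>2 = 2 * N - B" using eqs(2) by simp
    then have "B + T\<^sup>2 = 2 * N" by simp
    with eqs(1) have "N\<^sup>2 - 2 * N * N + E = 0" by simp
    then have "N\<^sup>2 = E" by (simp add: power2_eq_square)
    then have "\<bar>N\<bar> = sqrt E" by auto
    moreover have "N \<noteq> - sqrt E"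
      using assms(2) T2 zero_le_power2 [of T] by linarith
    ultimately have N: "N = sqrt E" by linarith
    then have "T\<^sup>2 = ?t\<^sup>2" using T2 t by simp
    then show "(T = ?t \<or> T = - ?t) \<and> N = sqrt E" using N by (simp add: power2_eq_iff)
  next
    assume *: "(T = ?t \<or> T = - ?t) \<and> N = sqrt E"
    then have T2: "T\<^sup>2 = 2 * sqrt E - B" using t(2) by auto
    have "N\<^sup>2 - (B + T\<^sup>2) * N + E = 0"
      using assms(1) by (simp add: T2 conjunct2 [OF *] algebra_simps flip: power2_eq_square)
    moreover have "T^3 + (B - 2 * N) * T = T * (T\<^sup>2 + B - 2 * N)"
      by (simp add: algebra_simps power3_eq_cube power2_eq_square)
    ultimately show "(T, N) \<in> trace_norm_pairs B E 0"
      using T2 * by (simp add: trace_norm_pairs_def)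
  qed
  then show ?thesis by auto
qed

text \<open>The cubic is z ((z + B)^2 - 4 E) - D^2. For z > 0 the factor z + B + 2 sqrt E is
  positive, so at a positive root z + B - 2 sqrt E must be positive as well. Where all three factors
  are positive the cubic is strictly increasing, which gives uniqueness; existence follows from the
  intermediate value theorem.\<close>

lemma resolvent_cubic_unique_root:
  fixes B E D :: real
  assumes "E \<ge> 0" "B > - 2 * sqrt E" "D \<noteq> 0"
  shows "\<exists>!z. z > 0 \<and> z^3 + 2 * B * z\<^sup>2 + (B\<^sup>2 - 4 * E) * z - D\<^sup>2 = 0"
proof -
  define f where "f z = z^3 + 2 * B * z\<^sup>2 + (B\<^sup>2 - 4 * E) * z - D\<^sup>2" for z
  have f: "f z = z * ((z + B - 2 * sqrt E) * (z + B + 2 * sqrt E)) - D\<^sup>2" for z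
  proof -
    have "(z + B - 2 * sqrt E) * (z + B + 2 * sqrt E) = (z + B)\<^sup>2 - 4 * (sqrt E)\<^sup>2"
      by (simp only: power2_eq_square) algebra
    then show ?thesis
      using assms(1) by (simp add: f_def algebra_simps power3_eq_cube power2_eq_square)
  qed
  have large: "z + B - 2 * sqrt E > 0" if "z > 0" "f z = 0" for z
  proof (rule ccontr)
    assume "\<not> z + B - 2 * sqrt E > 0"
    then have "z * ((z + B - 2 * sqrt E) * (z + B + 2 * sqrt E)) \<le> 0"
      using that(1) assms(2) by (intro mult_nonneg_nonpos mult_nonpos_nonneg) auto
    moreover have "D\<^sup>2 > 0" using assms(3) by simp
    ultimately show False using that(2) f by simp
  qed
  have mono: "f y < f z" if "y > 0" "y + B - 2 * sqrt E > 0" "y < z" for y z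
  proof -
    have "(y + B - 2 * sqrt E) * (y + B + 2 * sqrt E) < (z + B - 2 * sqrt E) * (z + B + 2 * sqrt E)"
      using that assms by (intro mult_strict_mono) auto
    then show ?thesis
      unfolding f using that assms by (auto intro!: mult_strict_mono)
  qed
  \<comment> \<open>An upper end for the intermediate value theorem: both linear factors are at
    least 1 at u, so f u is at least u - D^2, which is nonnegative.\<close>
  define u where "u = 1 + \<bar>B\<bar> + 2 * sqrt E + D\<^sup>2"
  have u: "u \<ge> 1" "u + B - 2 * sqrt E \<ge> 1" "u + B + 2 * sqrt E \<ge> 1" "u \<ge> D\<^sup>2"
    using assms(1) by (auto simp: u_def abs_if)
  have "1 * 1 \<le> (u + B - 2 * sqrt E) * (u + B + 2 * sqrt E)"
    using u by (intro mult_mono) auto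
  then have "u * 1 \<le> u * ((u + B - 2 * sqrt E) * (u + B + 2 * sqrt E))"
    using u(1) by (intro mult_left_mono) auto
  then have "f u \<ge> 0" using u(4) f [of u] by linarith
  moreover have "f 0 \<le> 0" by (simp add: f_def)
  moreover have "continuous_on {0..u} f"
    unfolding f_def by (intro continuous_intros)
  ultimately obtain z where z: "z \<ge> 0" "f z = 0"
    using IVT' [of f 0 0 u] u(1) by auto
  have "f 0 \<noteq> 0" using assms(3) by (simp add: f_def)
  with z have "z > 0" by (cases "z = 0") auto
  moreover have "y = z" if "y > 0" "f y = 0" "z > 0" "f z = 0" for y z
    using mono [of y z] mono [of z y] large that by (cases y z rule: linorder_cases) auto
  ultimately have "\<exists>!z. z > 0 \<and> f z = 0"
    using z(2) by blast
  then show ?thesis unfolding f_def .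
qed

text \<open>As D is nonzero, so is T, and the second equation determines N from T. Eliminating N
  from the first one leaves the resolvent cubic of the quartic, evaluated at T^2.\<close>

lemma trace_norm_pairs_cubic:
  assumes "D \<noteq> 0" and z: "z > 0" "z^3 + 2 * B * z\<^sup>2 + (B\<^sup>2 - 4 * E) * z - D\<^sup>2 = 0"
    and unique: "\<And>y. y > 0 \<Longrightarrow> y^3 + 2 * B * y\<^sup>2 + (B\<^sup>2 - 4 * E) * y - D\<^sup>2 = 0 \<Longrightarrow> y = z"
  shows "trace_norm_pairs B E D =
    {(T, (T^3 + B * T + D) / (2 * T)) | T. T = sqrt z \<or> T = - sqrt z}"
proof -
  have "(T, N) \<in> trace_norm_pairs B E D \<longleftrightarrow>
      (T = sqrt z \<or> T = - sqrt z) \<and> N = (T^3 + B * T + D) / (2 * T)" for T N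
  proof (cases "T = 0")
    case True
    then show ?thesis using assms(1) z(1) by (auto simp: trace_norm_pairs_def)
  next
    case False
    have N: "T^3 + (B - 2 * N) * T + D = 0 \<longleftrightarrow> N = (T^3 + B * T + D) / (2 * T)"
      using False by (auto simp: field_simps)
    have *: "N\<^sup>2 - (B + T\<^sup>2) * N + E = 0 \<longleftrightarrow> T = sqrt z \<or> T = - sqrt z"
      if "N = (T^3 + B * T + D) / (2 * T)"
    proof -
      let ?W = "T\<^sup>2 + B"
      have NT: "2 * T * N = T * ?W + D"
        using False by (simp add: that field_simps power3_eq_cube power2_eq_square)
      \<comment> \<open>The factor 4 T^2 makes N occur only through 2 T N, which \<open>NT\<close>
        then replaces.\<close>
      have "4 * T\<^sup>2 * (N\<^sup>2 - (B + T\<^sup>2) * N + E)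
          = (2 * T * N)\<^sup>2 - 2 * T * ?W * (2 * T * N) + 4 * T\<^sup>2 * E"
        by (simp add: algebra_simps power2_eq_square)
      also have "\<dots> = - ((T\<^sup>2)^3 + 2 * B * (T\<^sup>2)\<^sup>2 + (B\<^sup>2 - 4 * E) * T\<^sup>2 - D\<^sup>2)"
        unfolding NT by (simp add: algebra_simps power2_eq_square power3_eq_cube)
      finally have eq: "4 * T\<^sup>2 * (N\<^sup>2 - (B + T\<^sup>2) * N + E)
          = - ((T\<^sup>2)^3 + 2 * B * (T\<^sup>2)\<^sup>2 + (B\<^sup>2 - 4 * E) * T\<^sup>2 - D\<^sup>2)" .
      have "N\<^sup>2 - (B + T\<^sup>2) * N + E = 0 \<longleftrightarrow>
          4 * T\<^sup>2 * (N\<^sup>2 - (B + T\<^sup>2) * N + E) = 0"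
        using False by simp
      also have "\<dots> \<longleftrightarrow>
          (T\<^sup>2)^3 + 2 * B * (T\<^sup>2)\<^sup>2 + (B\<^sup>2 - 4 * E) * T\<^sup>2 - D\<^sup>2 = 0"
        unfolding eq by (rule neg_equal_0_iff_equal)
      also have "\<dots> \<longleftrightarrow> T\<^sup>2 = z"
        using unique [of "T\<^sup>2"] z False by auto
      also have "\<dots> \<longleftrightarrow> T\<^sup>2 = (sqrt z)\<^sup>2" using z(1) by simp
      finally show ?thesis by (simp add: power2_eq_iff)
    qed
    show ?thesis using * N by (auto simp: trace_norm_pairs_def)
  qed
  then show ?thesis by auto
qed

text \<open>Supplies the bound B > - 2 sqrt E for the real system: |b|^2 is positive and Re c is at
  least - |c|.\<close>

lemma trace_coefficient_gt:
  fixes b c :: octonion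
  assumes "b \<noteq> 0"
  shows "(norm b)\<^sup>2 + 2 * Re_oct c > - 2 * sqrt ((norm c)\<^sup>2)"
proof -
  have "(norm b)\<^sup>2 > 0" using assms by simp
  moreover have "- norm c \<le> Re_oct c" using abs_Re_oct_le_norm [of c] by linarith
  moreover have "sqrt ((norm c)\<^sup>2) = norm c" by simp
  ultimately show ?thesis by linarith
qed

section \<open>The four cases\<close>

theorem theorem2p3:
  fixes b c :: octonion
  shows
    "(b \<in> oct_Reals \<and> c \<in> oct_Reals \<and> (Re_oct b)\<^sup>2 \<ge> 4 * Re_oct c \<longrightarrow>
        oct_left_quadratic_solutions b c =
          {oct_of_real ((- Re_oct b + sqrt ((Re_oct b)\<^sup>2 - 4 * Re_oct c)) / 2),
           oct_of_real ((- Re_oct b - sqrt ((Re_oct b)\<^sup>2 - 4 * Re_oct c)) / 2)})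
   \<and> (b \<in> oct_Reals \<and> c \<in> oct_Reals \<and> (Re_oct b)\<^sup>2 < 4 * Re_oct c \<longrightarrow>
        oct_left_quadratic_solutions b c =
          {(1/2) *\<^sub>R (- b + \<alpha> *\<^sub>R oct_i + \<beta> *\<^sub>R oct_j + \<gamma> *\<^sub>R oct_k + \<delta> *\<^sub>R oct_l
              + p *\<^sub>R (oct_i * oct_l) + q *\<^sub>R (oct_j * oct_l) + r *\<^sub>R (oct_k * oct_l))
           | \<alpha> \<beta> \<gamma> \<delta> p q r :: real.
             \<alpha>\<^sup>2 + \<beta>\<^sup>2 + \<gamma>\<^sup>2 + \<delta>\<^sup>2 + p\<^sup>2 + q\<^sup>2 + r\<^sup>2 = 4 * Re_oct c - (Re_oct b)\<^sup>2})
   \<and> (b \<in> oct_Reals \<and> c \<notin> oct_Reals \<longrightarrow>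
        (\<forall>c0 c1 c2 c3 c4 c5 c6 c7 :: real.
           c = c0 *\<^sub>R 1 + c1 *\<^sub>R oct_i + c2 *\<^sub>R oct_j + c3 *\<^sub>R oct_k + c4 *\<^sub>R oct_l
             + c5 *\<^sub>R (oct_i * oct_l) + c6 *\<^sub>R (oct_j * oct_l) + c7 *\<^sub>R (oct_k * oct_l) \<longrightarrow>
           (let \<rho> = sqrt (((Re_oct b)\<^sup>2 - 4 * c0
                      + sqrt (((Re_oct b)\<^sup>2 - 4 * c0)\<^sup>2
                          + 16 * (c1\<^sup>2 + c2\<^sup>2 + c3\<^sup>2 + c4\<^sup>2 + c5\<^sup>2 + c6\<^sup>2 + c7\<^sup>2))) / 2)
            in oct_left_quadratic_solutions b c =
                 {(1/2) *\<^sub>R (- b) + (\<rho> / 2) *\<^sub>R 1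
                    - (c1 / \<rho>) *\<^sub>R oct_i - (c2 / \<rho>) *\<^sub>R oct_j - (c3 / \<rho>) *\<^sub>R oct_k
                    - (c4 / \<rho>) *\<^sub>R oct_l - (c5 / \<rho>) *\<^sub>R (oct_i * oct_l)
                    - (c6 / \<rho>) *\<^sub>R (oct_j * oct_l) - (c7 / \<rho>) *\<^sub>R (oct_k * oct_l),
                  (1/2) *\<^sub>R (- b) - (\<rho> / 2) *\<^sub>R 1
                    + (c1 / \<rho>) *\<^sub>R oct_i + (c2 / \<rho>) *\<^sub>R oct_j + (c3 / \<rho>) *\<^sub>R oct_k
                    + (c4 / \<rho>) *\<^sub>R oct_l + (c5 / \<rho>) *\<^sub>R (oct_i * oct_l)
                    + (c6 / \<rho>) *\<^sub>R (oct_j * oct_l) + (c7 / \<rho>) *\<^sub>R (oct_k * oct_l)})))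
   \<and> (b \<notin> oct_Reals \<longrightarrow>
        (let b' = Im_oct b;
             c' = c - (Re_oct b / 2) *\<^sub>R (b - oct_of_real (Re_oct b / 2));
             B = (norm b')\<^sup>2 + 2 * Re_oct c';
             E = (norm c')\<^sup>2;
             D = 2 * Re_oct (cnj_oct b' * c');
             sol = (\<lambda>T N :: real. oct_of_real (- Re_oct b / 2)
                      - inverse (b' + oct_of_real T) * (c' - oct_of_real N))
         in b' = b - oct_of_real (Re_oct b)
          \<and> oct_of_real B = b' * cnj_oct b' + c' + cnj_oct c'
          \<and> oct_of_real E = c' * cnj_oct c'
          \<and> oct_of_real D = cnj_oct b' * c' + cnj_oct c' * b'
          \<and> (D = 0 \<and> B\<^sup>2 \<ge> 4 * E \<longrightarrow>
               oct_left_quadratic_solutions b c =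
                 {sol 0 ((B + sqrt (B\<^sup>2 - 4 * E)) / 2),
                  sol 0 ((B - sqrt (B\<^sup>2 - 4 * E)) / 2)})
          \<and> (D = 0 \<and> B\<^sup>2 < 4 * E \<longrightarrow>
               oct_left_quadratic_solutions b c =
                 {sol (sqrt (2 * sqrt E - B)) (sqrt E),
                  sol (- sqrt (2 * sqrt E - B)) (sqrt E)})
          \<and> (D \<noteq> 0 \<longrightarrow>
               (\<exists>!z::real. z > 0 \<and> z^3 + 2 * B * z\<^sup>2 + (B\<^sup>2 - 4 * E) * z - D\<^sup>2 = 0)
             \<and> (\<forall>z::real. z > 0 \<and> z^3 + 2 * B * z\<^sup>2 + (B\<^sup>2 - 4 * E) * z - D\<^sup>2 = 0 \<longrightarrow>
                  oct_left_quadratic_solutions b c =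
                    {sol T ((T^3 + B * T + D) / (2 * T)) | T. T = sqrt z \<or> T = - sqrt z}))))"
proof (intro conjI impI, goal_cases)

  \<comment> \<open>Real coefficients with nonnegative discriminant\<close>
  case 1
  then show ?case
    using left_quadratic_real_nonneg [of "Re_oct c" "Re_oct b"] by (simp add: oct_of_real_Re)
next

  \<comment> \<open>Real coefficients with negative discriminant\<close>
  case 2
  then have *: "oct_of_real (Re_oct b) = b" "oct_of_real (Re_oct c) = c"
    by (simp_all add: oct_of_real_Re)
  let ?y = "\<lambda>\<alpha> \<beta> \<gamma> \<delta> p q r. (1/2) *\<^sub>R (- b + \<alpha> *\<^sub>R oct_i + \<beta> *\<^sub>R oct_j + \<gamma> *\<^sub>R oct_k
    + \<delta> *\<^sub>R oct_l + p *\<^sub>R (oct_i * oct_l) + q *\<^sub>R (oct_j * oct_l) + r *\<^sub>R (oct_k * oct_l))"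
  have y: "?y \<alpha> \<beta> \<gamma> \<delta> p q r = (1/2) *\<^sub>R Oct (Quat (- Re_oct b) \<alpha> \<beta> \<gamma>) (Quat \<delta> p q r)"
    for \<alpha> \<beta> \<gamma> \<delta> p q r
    unfolding oct_basis_sum [symmetric] by (subst (1) *(1) [symmetric]) (simp add: oct_of_real_def)
  have "x \<in> oct_left_quadratic_solutions b c \<longleftrightarrow> (\<exists>\<alpha> \<beta> \<gamma> \<delta> p q r. x = ?y \<alpha> \<beta> \<gamma> \<delta> p q r \<and>
      \<alpha>\<^sup>2 + \<beta>\<^sup>2 + \<gamma>\<^sup>2 + \<delta>\<^sup>2 + p\<^sup>2 + q\<^sup>2 + r\<^sup>2 = 4 * Re_oct c - (Re_oct b)\<^sup>2)" for x
  proof -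
    have "x \<in> oct_left_quadratic_solutions b c \<longleftrightarrow>
        2 * Re_oct x = - Re_oct b \<and> (norm (2 *\<^sub>R Im_oct x))\<^sup>2 = 4 * Re_oct c - (Re_oct b)\<^sup>2"
      using left_quadratic_real_neg [of "Re_oct b" "Re_oct c" x] 2 * by simp
    also have "\<dots> \<longleftrightarrow> (\<exists>\<alpha> \<beta> \<gamma> \<delta> p q r. x = ?y \<alpha> \<beta> \<gamma> \<delta> p q r \<and>
        \<alpha>\<^sup>2 + \<beta>\<^sup>2 + \<gamma>\<^sup>2 + \<delta>\<^sup>2 + p\<^sup>2 + q\<^sup>2 + r\<^sup>2 = 4 * Re_oct c - (Re_oct b)\<^sup>2)"
      (is "?l \<longleftrightarrow> ?r")
    proof
      assume l: ?l
      \<comment> \<open>The parameters are the imaginary coordinates of x, doubled to cancel the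
        factor 1/2 in \<open>?y\<close>.\<close>
      have "x = ?y (2 * Qi (HL x)) (2 * Qj (HL x)) (2 * Qk (HL x))
          (2 * Q1 (HR x)) (2 * Qi (HR x)) (2 * Qj (HR x)) (2 * Qk (HR x))"
        using l unfolding y by (simp add: octonion_component_simps Re_oct_def)
      moreover have "(2 * Qi (HL x))\<^sup>2 + (2 * Qj (HL x))\<^sup>2 + (2 * Qk (HL x))\<^sup>2 + (2 * Q1 (HR x))\<^sup>2
          + (2 * Qi (HR x))\<^sup>2 + (2 * Qj (HR x))\<^sup>2 + (2 * Qk (HR x))\<^sup>2
          = 4 * Re_oct c - (Re_oct b)\<^sup>2"
        using l unfolding norm_octonion_squared by (simp add: Im_oct_def)
      ultimately show ?r by blast
    next
      assume ?r
      then obtain \<alpha> \<beta> \<gamma> \<delta> p q r where "x = ?y \<alpha> \<beta> \<gamma> \<delta> p q r"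
        and sum: "\<alpha>\<^sup>2 + \<beta>\<^sup>2 + \<gamma>\<^sup>2 + \<delta>\<^sup>2 + p\<^sup>2 + q\<^sup>2 + r\<^sup>2 = 4 * Re_oct c - (Re_oct b)\<^sup>2"
        by blast
      then have x: "x = (1/2) *\<^sub>R Oct (Quat (- Re_oct b) \<alpha> \<beta> \<gamma>) (Quat \<delta> p q r)"
        by (simp only: y)
      have "2 * Re_oct x = - Re_oct b"
        unfolding x Re_oct_def by simp
      moreover have "(norm (2 *\<^sub>R Im_oct x))\<^sup>2 = 4 * Re_oct c - (Re_oct b)\<^sup>2"
        unfolding x sum [symmetric] norm_octonion_squared by (simp add: Im_oct_def)
      ultimately show ?l ..
    qed
    finally show ?thesis .
  qed
  then show ?case by blast
next

  \<comment> \<open>Real linear coefficient and nonreal constant term\<close>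
  case 3
  then have b: "oct_of_real (Re_oct b) = b" and c: "c \<notin> oct_Reals"
    by (simp_all add: oct_of_real_Re)
  show ?case
  proof (intro allI impI, goal_cases)
    case (1 c0 c1 c2 c3 c4 c5 c6 c7)
    then have c_Oct: "c = Oct (Quat c0 c1 c2 c3) (Quat c4 c5 c6 c7)"
      by (simp only: oct_basis_sum)
    have Re_c: "Re_oct c = c0" by (simp add: c_Oct Re_oct_def)
    have norm_c: "(norm (Im_oct c))\<^sup>2 = c1\<^sup>2 + c2\<^sup>2 + c3\<^sup>2 + c4\<^sup>2 + c5\<^sup>2 + c6\<^sup>2 + c7\<^sup>2"
      unfolding norm_octonion_squared by (simp add: c_Oct Im_oct_def)
    have Im_c: "Im_oct c = c1 *\<^sub>R oct_i + c2 *\<^sub>R oct_j + c3 *\<^sub>R oct_k + c4 *\<^sub>R oct_l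
        + c5 *\<^sub>R (oct_i * oct_l) + c6 *\<^sub>R (oct_j * oct_l) + c7 *\<^sub>R (oct_k * oct_l)"
      using oct_basis_sum [of 0 c1 c2 c3 c4 c5 c6 c7]
      by (simp add: c_Oct Im_oct_def octonion_component_simps)
    define \<rho> where "\<rho> = sqrt (((Re_oct b)\<^sup>2 - 4 * c0 + sqrt (((Re_oct b)\<^sup>2 - 4 * c0)\<^sup>2
        + 16 * (c1\<^sup>2 + c2\<^sup>2 + c3\<^sup>2 + c4\<^sup>2 + c5\<^sup>2 + c6\<^sup>2 + c7\<^sup>2))) / 2)"
    \<comment> \<open>The right-hand sides use \<open>oct_of_real (Re_oct b)\<close>, for which the
      identities hold coordinatewise; unfolding \<open>b\<close> then restores b itself.\<close>
    have "oct_of_real ((- Re_oct b + \<rho>) / 2)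
        = (1/2) *\<^sub>R (- oct_of_real (Re_oct b)) + (\<rho> / 2) *\<^sub>R 1"
      "oct_of_real ((- Re_oct b - \<rho>) / 2)
        = (1/2) *\<^sub>R (- oct_of_real (Re_oct b)) - (\<rho> / 2) *\<^sub>R 1"
      by (simp_all add: octonion_component_simps add_divide_distrib diff_divide_distrib)
    note real_parts = this [unfolded b]
    have solutions: "oct_of_real ((- Re_oct b + \<rho>) / 2) - (1 / \<rho>) *\<^sub>R Im_oct c
        = (1/2) *\<^sub>R (- b) + (\<rho> / 2) *\<^sub>R 1
          - (c1 / \<rho>) *\<^sub>R oct_i - (c2 / \<rho>) *\<^sub>R oct_j - (c3 / \<rho>) *\<^sub>R oct_k
          - (c4 / \<rho>) *\<^sub>R oct_l - (c5 / \<rho>) *\<^sub>R (oct_i * oct_l)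
          - (c6 / \<rho>) *\<^sub>R (oct_j * oct_l) - (c7 / \<rho>) *\<^sub>R (oct_k * oct_l)"
      "oct_of_real ((- Re_oct b - \<rho>) / 2) + (1 / \<rho>) *\<^sub>R Im_oct c
        = (1/2) *\<^sub>R (- b) - (\<rho> / 2) *\<^sub>R 1
          + (c1 / \<rho>) *\<^sub>R oct_i + (c2 / \<rho>) *\<^sub>R oct_j + (c3 / \<rho>) *\<^sub>R oct_k
          + (c4 / \<rho>) *\<^sub>R oct_l + (c5 / \<rho>) *\<^sub>R (oct_i * oct_l)
          + (c6 / \<rho>) *\<^sub>R (oct_j * oct_l) + (c7 / \<rho>) *\<^sub>R (oct_k * oct_l)"
      unfolding real_parts Im_c by (simp_all add: algebra_simps)
    show ?case
      using left_quadratic_real_nonreal [OF c, of "Re_oct b"]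
      unfolding b norm_c Re_c Let_def \<rho>_def [symmetric] solutions .
  qed
next

  \<comment> \<open>Nonreal linear coefficient\<close>
  case 4
  define b' where "b' = Im_oct b"
  define c' where "c' = c - (Re_oct b / 2) *\<^sub>R (b - oct_of_real (Re_oct b / 2))"
  define B where "B = (norm b')\<^sup>2 + 2 * Re_oct c'"
  define E where "E = (norm c')\<^sup>2"
  define D where "D = 2 * Re_oct (cnj_oct b' * c')"
  define sol where "sol = (\<lambda>T N. oct_of_real (- Re_oct b / 2)
    - inverse (b' + oct_of_real T) * (c' - oct_of_real N))"
  have b': "b' \<noteq> 0" using 4 by (simp add: b'_def Im_oct_eq_0_iff)
  have B: "B > - 2 * sqrt E" unfolding B_def E_def by (rule trace_coefficient_gt [OF b'])
  have E: "E \<ge> 0" by (simp add: E_def)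
  have sols: "oct_left_quadratic_solutions b c = (\<lambda>(T, N). sol T N) ` trace_norm_pairs B E D"
    unfolding sol_def trace_norm_pairs_def B_def D_def E_def c'_def b'_def
    by (rule left_quadratic_nonreal [OF 4])
  have real_B: "oct_of_real B = b' * cnj_oct b' + c' + cnj_oct c'"
  proof -
    have "oct_of_real B = oct_of_real ((norm b')\<^sup>2) + 2 *\<^sub>R oct_of_real (Re_oct c')"
      by (simp add: B_def oct_of_real_def algebra_simps)
    then show ?thesis by (simp add: oct_of_real_norm_sq oct_of_real_Re_oct)
  qed
  have real_D: "oct_of_real D = cnj_oct b' * c' + cnj_oct c' * b'"
    by (simp add: D_def Re_oct_def octonion_component_simps algebra_simps)
  have root: "\<exists>!z. z > 0 \<and> z^3 + 2 * B * z\<^sup>2 + (B\<^sup>2 - 4 * E) * z - D\<^sup>2 = 0" if "D \<noteq> 0"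
    by (rule resolvent_cubic_unique_root [OF E B that])
  have cubic: "oct_left_quadratic_solutions b c =
      {sol T ((T^3 + B * T + D) / (2 * T)) | T. T = sqrt z \<or> T = - sqrt z}"
    if "D \<noteq> 0" "z > 0 \<and> z^3 + 2 * B * z\<^sup>2 + (B\<^sup>2 - 4 * E) * z - D\<^sup>2 = 0" for z
  proof -
    have "trace_norm_pairs B E D =
        {(T, (T^3 + B * T + D) / (2 * T)) | T. T = sqrt z \<or> T = - sqrt z}"
      \<comment> \<open>\<open>root\<close> provides the uniqueness that identifies every admissible
        T^2 with the given z.\<close>
      using that root by (intro trace_norm_pairs_cubic) blast+
    then show ?thesis unfolding sols by auto
  qed
  have real_norms: "oct_left_quadratic_solutions b c =
      {sol 0 ((B + sqrt (B\<^sup>2 - 4 * E)) / 2), sol 0 ((B - sqrt (B\<^sup>2 - 4 * E)) / 2)}"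
    if "D = 0 \<and> B\<^sup>2 \<ge> 4 * E"
    using that sols trace_norm_pairs_real_norms [OF E B] by simp
  have complex_norms: "oct_left_quadratic_solutions b c =
      {sol (sqrt (2 * sqrt E - B)) (sqrt E), sol (- sqrt (2 * sqrt E - B)) (sqrt E)}"
    if "D = 0 \<and> B\<^sup>2 < 4 * E"
    using that sols trace_norm_pairs_complex_norms [OF E B] by simp
  have real_E: "oct_of_real E = c' * cnj_oct c'"
    unfolding E_def by (rule oct_of_real_norm_sq)
  have Im_b: "b' = b - oct_of_real (Re_oct b)"
    unfolding b'_def by (rule Im_oct_conv)
  show ?case
    unfolding Let_def b'_def [symmetric] c'_def [symmetric] B_def [symmetric] E_def [symmetric]
      D_def [symmetric]
    by (intro conjI allI impI)
      (rule Im_b real_B real_E real_D root real_norms [unfolded sol_def]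
        complex_norms [unfolded sol_def] cubic [unfolded sol_def] | assumption)+
qed

end
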